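(* Let $(X,\|\cdot\|)$ be a real Banach space, let $\emptyset\ne\mathcal F\subset\overline{\mathbb R}^{X}$, and let $\partial:\overline{\mathbb R}^{X}\times X\rightrightarrows X^*$ be an abstract subdifferential on $\mathcal F$. Then, for every $x\in X$ and every $f\in\mathcal F$ that is lower semicontinuous near $x$ (i.e. on a neighborhood of $x$), $$\eth f(x)\subset s\times w^*\text{-}\operatorname{Limsup}_{y\to x}\partial f(y).$$
   Context: $\overline{\mathbb R}=[-\infty,+\infty]$; $s$ is the norm topology of $X$, $w^*$ the weak-star topology of $X^*$, and $\langle x,x^*\rangle:=x^*(x)$. $\overline B(x_0;r)$ is the closed norm ball. Core subdifferential (for the norm metric): for $f:X\to\overline{\mathbb R}$ and $x_0\in X$, $x_0^*\in X^*$ belongs to $\eth f(x_0)$ if $f(x_0)\in\mathbb R$ and there is a family $(\delta_\varepsilon)_{\varepsilon>0}\subset(0,+\infty)$ with $\limsup_{\varepsilon\downarrow0}\delta_\varepsilon/\varepsilon=+\infty$ such that $f(x_0)+\langle x-x_0,x_0^*\rangle\le f(x)+\varepsilon$ for every $\varepsilon>0$ and every $x\in\overline B(x_0;\delta_\varepsilon)$. If $f(x_0)\notin\mathbb R$, then $\eth f(x_0)=\emptyset$. Outer limit: $x^*\in s\times w^*\text{-}\operatorname{Limsup}_{y\to x}\partial f(y)$ means that there is a net $((y_i,y_i^* ))_i$ with $y_i^*\in\partial f(y_i)$ for all $i$, $y_i\to x$ in norm, $y_i^*\to x^*$ weak-star, and $f(y_i)\to f(x)$. Abstract subdifferential: a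 multifunction $\partial:\overline{\mathbb R}^{X}\times X\rightrightarrows X^*$, $(f,x)\mapsto\partial f(x)$, is an abstract subdifferential on $\mathcal F$ if the following property [P] holds: whenever $f\in\mathcal F$, $g:X\to\mathbb R$ is convex and continuous, $x\in X$, $f(x)$ is finite, $f$ is lower semicontinuous near $x$, and $x$ is a local minimum point of $f+g$, then $$0\in s\times w^*\text{-}\operatorname{Limsup}_{y\to x}\partial f(y)+\partial_F g(x),$$ where $\partial_F g(x)=\{x^*\in X^*\mid g(x)+\langle u-x,x^*\rangle\le g(u)\ \forall u\in X\}$ is the Fenchel subdifferential. *)

theory Defs
  imports "HOL-Analysis.Analysis"
begin

text \<open>
  The dual space of \<open>'a\<close> is the type \<open>'a \<Rightarrow>\<^sub>L real\<close> of bounded linear functionals. Its weak-star topology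
  is the topology of pointwise convergence, i.e. the strong operator topology of the library
  specialised to scalar-valued operators.
\<close>

abbreviation weak_star :: "('a::real_normed_vector \<Rightarrow>\<^sub>L real) topology" where
  "weak_star \<equiv> strong_operator_topology"

definition directed_on :: "'i set \<Rightarrow> ('i \<Rightarrow> 'i \<Rightarrow> bool) \<Rightarrow> bool" where
  "directed_on I le \<longleftrightarrow> I \<noteq> {} \<and> reflp_on I le \<and> transp_on I le \<and>
     (\<forall>i\<in>I. \<forall>j\<in>I. \<exists>k\<in>I. le i k \<and> le j k)"

definition net_filter :: "'i set \<Rightarrow> ('i \<Rightarrow> 'i \<Rightarrow> bool) \<Rightarrow> 'i filter" where
  "net_filter I le = (INF i\<in>I. principal {j\<in>I. le i j})"

lemma eventually_net_filter:
  assumes "directed_on I le"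
  shows "eventually P (net_filter I le) \<longleftrightarrow> (\<exists>i\<in>I. \<forall>j\<in>I. le i j \<longrightarrow> P j)"
proof -
  have "eventually P (net_filter I le) \<longleftrightarrow> (\<exists>i\<in>I. eventually P (principal {j\<in>I. le i j}))"
    unfolding net_filter_def
  proof (rule eventually_INF_base)
    show "I \<noteq> {}" using assms by (simp add: directed_on_def)
    fix i j assume ij: "i \<in> I" "j \<in> I"
    then obtain k where k: "k \<in> I" "le i k" "le j k"
      using assms by (meson directed_on_def)
    have "{l\<in>I. le k l} \<subseteq> {l\<in>I. le i l} \<inter> {l\<in>I. le j l}"
      using assms ij k unfolding directed_on_def transp_on_def by blast
    then show "\<exists>k\<in>I. principal {l\<in>I. le k l} \<le> inf (principal {l\<in>I. le i l}) (principal {l\<in>I. le j l})"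
      using k by auto
  qed
  then show ?thesis by (auto simp: eventually_principal)
qed

text \<open>
  HOL does not allow quantifying over the index type of a net inside a definition, so the index
  sets below are carved out of one fixed type. The lemma \<open>sw_LimsupI\<close> shows that this type is rich
  enough: nets over an arbitrary index type yield the same outer limit.
\<close>

definition sw_Limsup ::
  "('a::real_normed_vector \<Rightarrow> ereal) \<Rightarrow> ('a \<Rightarrow> ('a \<Rightarrow>\<^sub>L real) set) \<Rightarrow> 'a \<Rightarrow> ('a \<Rightarrow>\<^sub>L real) set" where
  "sw_Limsup f M x = {xs. \<exists>(I :: ('a \<times> ('a \<Rightarrow>\<^sub>L real)) set set) le y ys.
     directed_on I le \<and>
     (\<forall>i\<in>I. ys i \<in> M (y i)) \<and>
     (y \<longlongrightarrow> x) (net_filter I le) \<and>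
     limitin weak_star ys xs (net_filter I le) \<and>
     ((\<lambda>i. f (y i)) \<longlongrightarrow> f x) (net_filter I le)}"

lemma sw_LimsupI:
  fixes f :: "'a::real_normed_vector \<Rightarrow> ereal" and I :: "'i set"
  assumes dir: "directed_on I le"
    and M: "\<And>i. i \<in> I \<Longrightarrow> ys i \<in> M (y i)"
    and y: "(y \<longlongrightarrow> x) (net_filter I le)"
    and ys: "limitin weak_star ys xs (net_filter I le)"
    and fy: "((\<lambda>i. f (y i)) \<longlongrightarrow> f x) (net_filter I le)"
  shows "xs \<in> sw_Limsup f M x"
proof -
  define T where "T i = (\<lambda>j. (y j, ys j)) ` {j\<in>I. le i j}" for i
  define J where "J = T ` I"
  define z where "z A = (SOME p. p \<in> A)" for A :: "('a \<times> ('a \<Rightarrow>\<^sub>L real)) set"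
  let ?ge = "\<lambda>A B :: ('a \<times> ('a \<Rightarrow>\<^sub>L real)) set. B \<subseteq> A"
  have z: "z A \<in> A" if "A \<in> J" for A
  proof -
    obtain i where "i \<in> I" "A = T i" using \<open>A \<in> J\<close> unfolding J_def by blast
    moreover have "le i i"
      using \<open>i \<in> I\<close> dir by (auto simp: directed_on_def reflp_on_def)
    ultimately have "(y i, ys i) \<in> A" by (auto simp: T_def)
    then show ?thesis unfolding z_def by (rule someI)
  qed
  have dirJ: "directed_on J ?ge"
    unfolding directed_on_def
  proof (intro conjI ballI)
    show "J \<noteq> {}" using dir by (auto simp: J_def directed_on_def)
    show "reflp_on J ?ge" by (auto simp: reflp_on_def)
    show "transp_on J ?ge" by (auto simp: transp_on_def)
    fix A B assume "A \<in> J" "B \<in> J"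
    then obtain i j where ij: "i \<in> I" "j \<in> I" "A = T i" "B = T j" unfolding J_def by blast
    then obtain k where k: "k \<in> I" "le i k" "le j k"
      using dir by (meson directed_on_def)
    have "{l\<in>I. le k l} \<subseteq> {l\<in>I. le i l} \<inter> {l\<in>I. le j l}"
      using dir ij k unfolding directed_on_def transp_on_def by blast
    then have "T k \<subseteq> A \<and> T k \<subseteq> B" using ij by (auto simp: T_def)
    then show "\<exists>C\<in>J. C \<subseteq> A \<and> C \<subseteq> B" using k by (auto simp: J_def)
  qed
  have ev: "eventually (\<lambda>A. P (fst (z A)) (snd (z A))) (net_filter J ?ge)"
    if P: "eventually (\<lambda>i. P (y i) (ys i)) (net_filter I le)" for P
  proof -
    obtain i where i: "i \<in> I" "\<forall>j\<in>I. le i j \<longrightarrow> P (y j) (ys j)"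
      using P eventually_net_filter[OF dir, of "\<lambda>i. P (y i) (ys i)"] by auto
    have "P (fst (z A)) (snd (z A))" if A: "A \<in> J" "A \<subseteq> T i" for A
    proof -
      have "z A \<in> T i" using z A by blast
      then show ?thesis using i by (auto simp: T_def)
    qed
    moreover have "T i \<in> J" using i by (simp add: J_def)
    ultimately show ?thesis
      unfolding eventually_net_filter[OF dirJ] by blast
  qed
  have "snd (z A) \<in> M (fst (z A))" if "A \<in> J" for A
    using z[OF that] that M by (auto simp: J_def T_def)
  moreover have "((\<lambda>A. fst (z A)) \<longlongrightarrow> x) (net_filter J ?ge)"
    using y unfolding tendsto_def by (auto intro: ev[where P="\<lambda>a b. a \<in> _"])
  moreover have "limitin weak_star (\<lambda>A. snd (z A)) xs (net_filter J ?ge)"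
    using ys unfolding limitin_def by (auto intro: ev[where P="\<lambda>a b. b \<in> _"])
  moreover have "((\<lambda>A. f (fst (z A))) \<longlongrightarrow> f x) (net_filter J ?ge)"
    using fy unfolding tendsto_def by (auto intro: ev[where P="\<lambda>a b. f a \<in> _"])
  ultimately show ?thesis
    unfolding sw_Limsup_def mem_Collect_eq
    by (intro exI[of _ J] exI[of _ ?ge] exI[of _ "\<lambda>A. fst (z A)"] exI[of _ "\<lambda>A. snd (z A)"])
      (simp add: dirJ)
qed

definition core_subdifferential ::
  "('a::real_normed_vector \<Rightarrow> ereal) \<Rightarrow> 'a \<Rightarrow> ('a \<Rightarrow>\<^sub>L real) set" where
  "core_subdifferential f x0 = {xs. \<bar>f x0\<bar> \<noteq> \<infinity> \<and>
     (\<exists>\<delta> :: real \<Rightarrow> real.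
        (\<forall>\<epsilon>>0. \<delta> \<epsilon> > 0) \<and>
        Limsup (at_right 0) (\<lambda>\<epsilon>. ereal (\<delta> \<epsilon> / \<epsilon>)) = \<infinity> \<and>
        (\<forall>\<epsilon>>0. \<forall>x\<in>cball x0 (\<delta> \<epsilon>).
           f x0 + ereal (blinfun_apply xs (x - x0)) \<le> f x + ereal \<epsilon>))}"

definition fenchel_subdifferential ::
  "('a::real_normed_vector \<Rightarrow> real) \<Rightarrow> 'a \<Rightarrow> ('a \<Rightarrow>\<^sub>L real) set" where
  "fenchel_subdifferential g x = {xs. \<forall>u. g x + blinfun_apply xs (u - x) \<le> g u}"

definition lsc_near :: "('a::topological_space \<Rightarrow> ereal) \<Rightarrow> 'a \<Rightarrow> bool" where
  "lsc_near f x \<longleftrightarrow> (\<exists>U. open U \<and> x \<in> U \<and>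
     (\<forall>z\<in>U. \<forall>c<f z. eventually (\<lambda>u. c < f u) (nhds z)))"

definition local_minimum_point :: "('a::topological_space \<Rightarrow> ereal) \<Rightarrow> 'a \<Rightarrow> bool" where
  "local_minimum_point h x \<longleftrightarrow> eventually (\<lambda>u. h x \<le> h u) (nhds x)"

text \<open>
  In the conclusion, \<open>+\<close> is the Minkowski sum of the outer limit and the Fenchel subdifferential.
\<close>

definition abstract_subdifferential ::
  "(('a::real_normed_vector \<Rightarrow> ereal) \<Rightarrow> 'a \<Rightarrow> ('a \<Rightarrow>\<^sub>L real) set) \<Rightarrow> ('a \<Rightarrow> ereal) set \<Rightarrow> bool" where
  "abstract_subdifferential D F \<longleftrightarrow>
     (\<forall>f\<in>F. \<forall>g :: 'a \<Rightarrow> real. \<forall>x.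
        convex_on UNIV g \<longrightarrow> continuous_on UNIV g \<longrightarrow> \<bar>f x\<bar> \<noteq> \<infinity> \<longrightarrow> lsc_near f x \<longrightarrow>
        local_minimum_point (\<lambda>u. f u + ereal (g u)) x \<longrightarrow>
        0 \<in> sw_Limsup f (D f) x + fenchel_subdifferential g x)"

end

theory Submission
  imports Defs
begin

text \<open>
  A core subgradient \<open>x\<^sub>0\<^sup>*\<close> of \<open>f\<close> at \<open>x\<^sub>0\<close> makes \<open>x\<^sub>0\<close> an \<open>\<epsilon>\<close>-minimizer of the tilted function
  \<open>f - \<langle>\<cdot> - x\<^sub>0, x\<^sub>0\<^sup>*\<rangle>\<close> on the ball of radius \<open>\<delta>\<^sub>\<epsilon>\<close>. Ekeland's variational principle, applied on
  a ball of radius \<open>\<rho> \<le> \<delta>\<^sub>\<epsilon>\<close>, replaces \<open>x\<^sub>0\<close> by a nearby point \<open>y\<close> that is an exact local minimizer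
  once a multiple of \<open>norm (\<cdot> - y)\<close>, with factor of order \<open>\<epsilon> / \<rho>\<close>, is added. As \<open>\<delta>\<^sub>\<epsilon> / \<epsilon>\<close> is
  unbounded for small \<open>\<epsilon>\<close>, both \<open>\<rho>\<close> and this factor can be made as small as desired.
  The tilt and the norm term together form a
  convex continuous function \<open>g\<close> whose Fenchel subgradients at \<open>y\<close> all lie in a small ball around
  \<open>- x\<^sub>0\<^sup>*\<close>, so the defining property of an abstract subdifferential yields a member of the outer
  limit at \<open>y\<close> that is close to \<open>x\<^sub>0\<^sup>*\<close> in norm (\<open>core_subdifferential_approx\<close>).

  It remains to pass from outer limits at nearby points to the outer limit at \<open>x\<^sub>0\<close>. This
  diagonal step is topological: the outer limit consists of the \<open>x\<^sup>*\<close> for which \<open>(x, x\<^sup>*, f x)\<close>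
  is in the closure of the set of all \<open>(y, y\<^sup>*, f y)\<close> with \<open>y\<^sup>*\<close> in the value at \<open>y\<close>
  (\<open>sw_Limsup_iff\<close>), and taking the closure twice adds nothing.
\<close>

section \<open>The outer limit as a closure\<close>

text \<open>
  For the direction from right to left, the net is indexed by the triples of neighbourhoods, ordered
  by reverse inclusion, with a point of the graph chosen in each.
\<close>

lemma sw_Limsup_iff:
  fixes f :: "'a::real_normed_vector \<Rightarrow> ereal"
  shows "xs \<in> sw_Limsup f M x \<longleftrightarrow>
    (\<forall>U V W. open U \<longrightarrow> x \<in> U \<longrightarrow> openin weak_star V \<longrightarrow> xs \<in> V \<longrightarrow> open W \<longrightarrow> f x \<in> W \<longrightarrow>
      (\<exists>y\<in>U. \<exists>ys\<in>V. ys \<in> M y \<and> f y \<in> W))"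
    (is "_ \<longleftrightarrow> ?closure")
proof
  assume "xs \<in> sw_Limsup f M x"
  then obtain I :: "('a \<times> ('a \<Rightarrow>\<^sub>L real)) set set" and le y ys where dir: "directed_on I le"
    and M: "\<And>i. i \<in> I \<Longrightarrow> ys i \<in> M (y i)"
    and lim: "(y \<longlongrightarrow> x) (net_filter I le)" "limitin weak_star ys xs (net_filter I le)"
      "((\<lambda>i. f (y i)) \<longlongrightarrow> f x) (net_filter I le)"
    unfolding sw_Limsup_def by blast
  show ?closure
  proof (intro allI impI)
    fix U V W
    assume U: "open U" "x \<in> U" and V: "openin weak_star V" "xs \<in> V" and W: "open W" "f x \<in> W"
    have "eventually (\<lambda>i. y i \<in> U \<and> ys i \<in> V \<and> f (y i) \<in> W) (net_filter I le)"
      using lim U V W by (auto simp: tendsto_def limitin_def eventually_conj_iff)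
    then obtain i where "i \<in> I" "\<And>j. j \<in> I \<Longrightarrow> le i j \<Longrightarrow> y j \<in> U \<and> ys j \<in> V \<and> f (y j) \<in> W"
      unfolding eventually_net_filter[OF dir] by blast
    moreover have "le i i"
      using \<open>i \<in> I\<close> dir by (auto simp: directed_on_def reflp_on_def)
    ultimately show "\<exists>y\<in>U. \<exists>ys\<in>V. ys \<in> M y \<and> f y \<in> W"
      using M by blast
  qed
next
  assume cl: ?closure
  define I where "I = {(U, V, W). open U \<and> x \<in> U \<and> openin weak_star V \<and> xs \<in> V \<and> open W \<and> f x \<in> W}"
  define le where "le = (\<lambda>(U, V, W) (U', V', W').
    U' \<subseteq> (U :: 'a set) \<and> V' \<subseteq> (V :: ('a \<Rightarrow>\<^sub>L real) set) \<and> W' \<subseteq> (W :: ereal set))"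
  have "\<forall>i\<in>I. \<exists>p. fst p \<in> fst i \<and> snd p \<in> fst (snd i) \<and> snd p \<in> M (fst p) \<and> f (fst p) \<in> snd (snd i)"
    using cl by (fastforce simp: I_def)
  then obtain p where p: "\<And>i. i \<in> I \<Longrightarrow> fst (p i) \<in> fst i \<and> snd (p i) \<in> fst (snd i) \<and>
      snd (p i) \<in> M (fst (p i)) \<and> f (fst (p i)) \<in> snd (snd i)"
    by metis
  have top: "(UNIV, UNIV, UNIV) \<in> I"
    using openin_topspace[of "weak_star :: ('a \<Rightarrow>\<^sub>L real) topology"]
    by (simp add: I_def strong_operator_topology_topspace)
  have dir: "directed_on I le"
    unfolding directed_on_def
  proof (intro conjI ballI)
    show "I \<noteq> {}" using top by blast
    show "reflp_on I le" by (auto simp: reflp_on_def le_def)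
    show "transp_on I le" by (auto simp: transp_on_def le_def)
    fix i j assume "i \<in> I" "j \<in> I"
    then show "\<exists>k\<in>I. le i k \<and> le j k"
      by (intro bexI[of _ "(fst i \<inter> fst j, fst (snd i) \<inter> fst (snd j), snd (snd i) \<inter> snd (snd j))"])
        (auto simp: I_def le_def)
  qed
  have ev: "eventually (\<lambda>i. fst (p i) \<in> U \<and> snd (p i) \<in> V \<and> f (fst (p i)) \<in> W) (net_filter I le)"
    if "(U, V, W) \<in> I" for U V W
    unfolding eventually_net_filter[OF dir]
    using that p by (intro bexI[of _ "(U, V, W)"]) (force simp: le_def)+
  show "xs \<in> sw_Limsup f M x"
  proof (rule sw_LimsupI[OF dir])
    show "snd (p i) \<in> M (fst (p i))" if "i \<in> I" for i
      using p[OF that] by blast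
    show "((\<lambda>i. fst (p i)) \<longlongrightarrow> x) (net_filter I le)"
      unfolding tendsto_def
    proof (intro allI impI)
      fix U assume "open U" "x \<in> U"
      then show "eventually (\<lambda>i. fst (p i) \<in> U) (net_filter I le)"
        using ev[of U UNIV UNIV] top by (auto simp: I_def elim: eventually_mono)
    qed
    show "limitin weak_star (\<lambda>i. snd (p i)) xs (net_filter I le)"
      unfolding limitin_def
    proof (intro conjI allI impI)
      show "xs \<in> topspace weak_star" by (simp add: strong_operator_topology_topspace)
      fix V assume "openin weak_star V \<and> xs \<in> V"
      then show "eventually (\<lambda>i. snd (p i) \<in> V) (net_filter I le)"
        using ev[of UNIV V UNIV] top by (auto simp: I_def elim: eventually_mono)
    qed
    show "((\<lambda>i. f (fst (p i))) \<longlongrightarrow> f x) (net_filter I le)"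
      unfolding tendsto_def
    proof (intro allI impI)
      fix W assume "open W" "f x \<in> W"
      then show "eventually (\<lambda>i. f (fst (p i)) \<in> W) (net_filter I le)"
        using ev[of UNIV UNIV W] top by (auto simp: I_def elim: eventually_mono)
    qed
  qed
qed

text \<open>
  A neighbourhood of \<open>(x, xs, f x)\<close> is also one of \<open>(y, ys, f y)\<close> once the latter is close enough,
  since weak-star neighbourhoods contain norm balls. It therefore meets the graph as soon as \<open>ys\<close>
  is in the outer limit at \<open>y\<close>.
\<close>

lemma sw_Limsup_norm_closed:
  fixes f :: "'a::real_normed_vector \<Rightarrow> ereal"
  assumes fin: "\<bar>f x\<bar> \<noteq> \<infinity>"
    and approx: "\<And>\<eta>. \<eta> > 0 \<Longrightarrow> \<exists>y ys. ys \<in> sw_Limsup f M y \<and> dist y x \<le> \<eta> \<and> dist ys xs \<le> \<eta> \<and>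
      \<bar>f y\<bar> \<noteq> \<infinity> \<and> \<bar>real_of_ereal (f y) - real_of_ereal (f x)\<bar> \<le> \<eta>"
  shows "xs \<in> sw_Limsup f M x"
  unfolding sw_Limsup_iff
proof (intro allI impI)
  fix U V W
  assume U: "open U" "x \<in> U" and V: "openin weak_star V" "xs \<in> V" and W: "open W" "f x \<in> W"
  have "open V"
    using openin_continuous_map_preimage[OF strong_operator_topology_weaker_than_euclidean V(1)]
    by simp
  then obtain b where b: "b > 0" "\<And>z. dist z xs \<le> b \<Longrightarrow> z \<in> V"
    using V(2) by (metis open_contains_cball mem_cball dist_commute subsetD)
  obtain a where a: "a > 0" "\<And>z. dist z x \<le> a \<Longrightarrow> z \<in> U"
    using U by (metis open_contains_cball mem_cball dist_commute subsetD)
  obtain c where c: "c > 0" "\<And>z. \<bar>z - real_of_ereal (f x)\<bar> \<le> c \<Longrightarrow> ereal z \<in> W"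
  proof -
    have "open (ereal -` W)" using W(1) by (simp add: open_ereal_vimage)
    moreover have "real_of_ereal (f x) \<in> ereal -` W" using W(2) fin by (simp add: ereal_real)
    ultimately obtain c where "c > 0" "cball (real_of_ereal (f x)) c \<subseteq> ereal -` W"
      by (meson open_contains_cball)
    then show ?thesis by (intro that[of c]) (auto simp: dist_real_def subset_iff abs_minus_commute)
  qed
  define \<eta> where "\<eta> = min a (min b c)"
  have \<eta>: "\<eta> > 0" "\<eta> \<le> a" "\<eta> \<le> b" "\<eta> \<le> c"
    using a b c by (auto simp: \<eta>_def)
  obtain y ys where y: "ys \<in> sw_Limsup f M y" "dist y x \<le> \<eta>" "dist ys xs \<le> \<eta>"
      "\<bar>f y\<bar> \<noteq> \<infinity>" "\<bar>real_of_ereal (f y) - real_of_ereal (f x)\<bar> \<le> \<eta>"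
    using approx[OF \<eta>(1)] by metis
  have "y \<in> U" "ys \<in> V"
    using y \<eta> a b by auto
  moreover have "f y \<in> W"
    using c(2)[of "real_of_ereal (f y)"] y \<eta> by (auto simp: ereal_real)
  ultimately show "\<exists>y\<in>U. \<exists>ys\<in>V. ys \<in> M y \<and> f y \<in> W"
    using y(1) U V W unfolding sw_Limsup_iff by blast
qed

section \<open>Ekeland's variational principle\<close>

text \<open>
  Moving from a point \<open>y\<close> to \<open>z\<close> is admissible if the decrease of \<open>f\<close> pays for the distance at rate
  \<open>t\<close>. A sequence of admissible moves, each nearly exhausting the decrease still available, is
  Cauchy because \<open>f\<close> is bounded below, and from its limit no admissible move is left.
\<close>

theorem Ekeland_real:
  fixes f :: "'a::metric_space \<Rightarrow> real"
  assumes S: "complete S" and x0: "x0 \<in> S" and t: "t > 0"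
    and bdd: "\<And>z. z \<in> S \<Longrightarrow> m \<le> f z"
    and lsc: "\<And>c. closed {z\<in>S. f z \<le> c}"
  obtains x where "x \<in> S" "f x + t * dist x x0 \<le> f x0"
    "\<And>z. z \<in> S \<Longrightarrow> z \<noteq> x \<Longrightarrow> f x < f z + t * dist z x"
proof -
  define T where "T y = {z\<in>S. f z + t * dist z y \<le> f y}" for y
  have T_refl: "y \<in> T y" if "y \<in> S" for y
    using that by (simp add: T_def)
  have T_trans: "z \<in> T w" if "z \<in> T y" "y \<in> T w" for z y w
  proof -
    have "t * dist z w \<le> t * dist z y + t * dist y w"
      using t by (metis dist_triangle distrib_left mult_left_mono less_imp_le)
    then show ?thesis using that by (simp add: T_def)
  qed
  have bddT: "bdd_below (f ` T y)" for y
    using bdd by (intro bdd_belowI[of _ m]) (auto simp: T_def)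
  have step: "\<exists>y'. y' \<in> T y \<and> f y' < Inf (f ` T y) + 1 / 2 ^ n" if "y \<in> S" for y n
  proof -
    have "Inf (f ` T y) < Inf (f ` T y) + 1 / 2 ^ n" by simp
    then show ?thesis
      using cInf_lessD[of "f ` T y"] T_refl[OF that] by fast
  qed
  define X where "X = rec_nat x0 (\<lambda>n y. SOME y'. y' \<in> T y \<and> f y' < Inf (f ` T y) + 1 / 2 ^ n)"
  have X_Suc: "X (Suc n) \<in> T (X n) \<and> f (X (Suc n)) < Inf (f ` T (X n)) + 1 / 2 ^ n" if "X n \<in> S" for n
    using someI_ex[OF step[OF that, of n]] by (simp add: X_def)
  have X0: "X 0 = x0" by (simp add: X_def)
  have XS: "X n \<in> S" for n
  proof (induction n)
    case (Suc n)
    then show ?case using X_Suc[OF Suc] by (simp add: T_def)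
  qed (simp add: X0 x0)
  have X_le: "X (n + k) \<in> T (X n)" for n k
  proof (induction k)
    case (Suc k)
    have "X (Suc (n + k)) \<in> T (X (n + k))"
      using X_Suc[OF XS] by blast
    then show ?case using T_trans[OF _ Suc] by simp
  qed (simp add: T_refl XS)
  have Xd: "f (X k) + t * dist (X k) (X n) \<le> f (X n)" if "n \<le> k" for n k
    using X_le[of n "k - n"] that by (simp add: T_def)
  have dec: "decseq (\<lambda>n. f (X n))"
    unfolding decseq_def
  proof (intro allI impI)
    fix n k :: nat assume "n \<le> k"
    then show "f (X k) \<le> f (X n)"
      using Xd[of n k] t by (smt (verit) mult_nonneg_nonneg zero_le_dist)
  qed
  then obtain L where L: "(\<lambda>n. f (X n)) \<longlonglongrightarrow> L" "\<And>n. L \<le> f (X n)"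
    using decseq_convergent[of "\<lambda>n. f (X n)" m] bdd XS by blast
  have "Cauchy X"
    unfolding Cauchy_altdef2
  proof (intro allI impI)
    fix e :: real assume "e > 0"
    then have "eventually (\<lambda>n. f (X n) < L + t * e) sequentially"
      using t by (intro order_tendstoD[OF L(1)]) simp
    then obtain N where N: "f (X N) < L + t * e"
      by (auto simp: eventually_sequentially)
    have "dist (X n) (X N) < e" if "n \<ge> N" for n
    proof -
      have "t * dist (X n) (X N) < t * e"
        using Xd[OF that] L(2)[of n] N by linarith
      then show ?thesis using t by simp
    qed
    then show "\<exists>N. \<forall>n\<ge>N. dist (X n) (X N) < e" by blast
  qed
  then obtain x where x: "x \<in> S" "X \<longlonglongrightarrow> x"
    using S XS unfolding complete_def by blast
  have fx: "f x \<le> L"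
  proof (rule field_le_epsilon)
    fix e :: real assume "e > 0"
    then have "eventually (\<lambda>n. f (X n) < L + e) sequentially"
      by (intro order_tendstoD[OF L(1)]) simp
    then have "eventually (\<lambda>n. X n \<in> {z\<in>S. f z \<le> L + e}) sequentially"
      by eventually_elim (simp add: XS)
    then have "x \<in> {z\<in>S. f z \<le> L + e}"
      using x(2) by (intro Lim_in_closed_set[OF lsc]) auto
    then show "f x \<le> L + e" by simp
  qed
  have xT: "x \<in> T (X n)" for n
  proof -
    have "(\<lambda>k. f (X k) + t * dist (X k) (X n)) \<longlonglongrightarrow> L + t * dist x (X n)"
      by (intro tendsto_intros L x)
    then have "L + t * dist x (X n) \<le> f (X n)"
      by (rule Lim_bounded[of _ _ n]) (auto intro: Xd)
    then show ?thesis using fx x(1) by (simp add: T_def)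
  qed
  show thesis
  proof
    show "x \<in> S" by fact
    show "f x + t * dist x x0 \<le> f x0"
      using xT[of 0] by (simp add: T_def X0)
    fix z assume z: "z \<in> S" "z \<noteq> x"
    show "f x < f z + t * dist z x"
    proof (rule ccontr)
      assume "\<not> ?thesis"
      then have zT: "z \<in> T x" using z by (simp add: T_def)
      \<comment> \<open>Such a \<open>z\<close> would be an admissible move from every \<open>X n\<close>, so that the infima approached
        by the sequence would not exceed \<open>f z\<close>.\<close>
      have "L \<le> f z + 1 / 2 ^ n" for n
      proof -
        have "Inf (f ` T (X n)) \<le> f z"
          using T_trans[OF zT xT] by (intro cInf_lower bddT) auto
        then show ?thesis
          using X_Suc[OF XS, of n] L(2)[of "Suc n"] by linarith
      qed
      moreover have "(\<lambda>n. f z + 1 / 2 ^ n) \<longlonglongrightarrow> f z + 0"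
        using LIMSEQ_divide_realpow_zero[of 2 "1::real"] by (intro tendsto_intros) simp
      ultimately have "L \<le> f z + 0"
        by (intro LIMSEQ_le_const) auto
      then have "f x \<le> f z" using fx by simp
      then have "t * dist z x \<le> 0" using zT by (simp add: T_def)
      then show False using t z(2) by (simp add: mult_le_0_iff)
    qed
  qed
qed

text \<open>
  The extended-valued case follows by restricting to the sublevel set of \<open>x\<^sub>0\<close>, on which the
  function is finite and which contains all competitors.
\<close>

corollary Ekeland_ereal:
  fixes f :: "'a::metric_space \<Rightarrow> ereal"
  assumes S: "complete S" and x0: "x0 \<in> S" and pos: "\<epsilon> > 0" "r > 0"
    and fin: "\<bar>f x0\<bar> \<noteq> \<infinity>"
    and min: "\<And>z. z \<in> S \<Longrightarrow> f x0 \<le> f z + ereal \<epsilon>"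
    and lsc: "\<And>c :: real. closed {z\<in>S. f z \<le> ereal c}"
  obtains x where "x \<in> S" "dist x x0 \<le> r" "f x \<le> f x0"
    "\<And>z. z \<in> S \<Longrightarrow> f x \<le> f z + ereal (\<epsilon> / r * dist z x)"
proof -
  obtain c where c: "f x0 = ereal c" using fin by auto
  define A where "A = {z\<in>S. f z \<le> ereal c}"
  define h where "h z = real_of_ereal (f z)" for z
  have fh: "f z = ereal (h z)" if "z \<in> A" for z
    using that min[of z] c by (cases "f z") (auto simp: A_def h_def)
  have "A = S \<inter> {z\<in>S. f z \<le> ereal c}" by (auto simp: A_def)
  then have "complete A"
    using complete_Int_closed[OF S lsc[of c]] by (simp only:)
  moreover have x0A: "x0 \<in> A" using x0 c by (simp add: A_def)
  moreover have "\<epsilon> / r > 0" using pos by simp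
  moreover have low: "c - \<epsilon> \<le> h z" if "z \<in> A" for z
    using min[of z] c fh[OF that] that by (simp add: A_def)
  moreover have "closed {z\<in>A. h z \<le> d}" for d
  proof -
    have "{z\<in>A. h z \<le> d} = {z\<in>S. f z \<le> ereal (min c d)}"
    proof (intro set_eqI iffI)
      fix z assume z: "z \<in> {z\<in>S. f z \<le> ereal (min c d)}"
      then have "f z \<le> ereal c" "f z \<le> ereal d"
        by (auto elim: order_trans)
      then show "z \<in> {z\<in>A. h z \<le> d}" using z fh[of z] by (auto simp: A_def)
    next
      fix z assume z: "z \<in> {z\<in>A. h z \<le> d}"
      then show "z \<in> {z\<in>S. f z \<le> ereal (min c d)}" using fh[of z] by (auto simp: A_def)
    qed
    then show ?thesis using lsc[of "min c d"] by (simp only:)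
  qed
  ultimately obtain x where x: "x \<in> A" "h x + \<epsilon> / r * dist x x0 \<le> h x0"
    "\<And>z. z \<in> A \<Longrightarrow> z \<noteq> x \<Longrightarrow> h x < h z + \<epsilon> / r * dist z x"
    using Ekeland_real[of A x0 "\<epsilon> / r" "c - \<epsilon>" h] by blast
  show thesis
  proof
    show "x \<in> S" "f x \<le> f x0" using x(1) c by (auto simp: A_def)
    have "\<epsilon> / r * dist x x0 \<le> \<epsilon>"
      using x(2) low[OF x(1)] fh[OF x0A] c by simp
    then show "dist x x0 \<le> r"
      using pos by (simp add: field_simps)
    fix z assume z: "z \<in> S"
    have nonneg: "0 \<le> \<epsilon> / r * dist z x" using pos by simp
    show "f x \<le> f z + ereal (\<epsilon> / r * dist z x)"
    proof (cases "z \<in> A")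
      case True
      have "h x \<le> h z + \<epsilon> / r * dist z x"
        using x(3)[OF True] by (cases "z = x") (auto intro: less_imp_le)
      then show ?thesis using fh[OF True] fh[OF x(1)] by simp
    next
      case False
      then have "f x \<le> f z" using z x(1) by (auto simp: A_def)
      also have "f z \<le> f z + ereal (\<epsilon> / r * dist z x)"
        using nonneg by (simp add: add_increasing2)
      finally show ?thesis .
    qed
  qed
qed

section \<open>Core subgradients as limits\<close>

text \<open>
  An infinite upper limit only provides good ratios \<open>\<delta> / \<epsilon>\<close> along arbitrarily small \<open>\<epsilon>\<close>; a single
  such pair is all that the approximation below consumes.
\<close>

lemma core_subdifferentialE:
  assumes "xs \<in> core_subdifferential f x" and "K > 0" and "e > 0"
  obtains \<epsilon> \<delta> where "\<epsilon> > 0" "\<epsilon> < e" "\<delta> > 0" "\<delta> > K * \<epsilon>"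
    "\<And>z. z \<in> cball x \<delta> \<Longrightarrow> f x + ereal (blinfun_apply xs (z - x)) \<le> f z + ereal \<epsilon>"
proof -
  obtain \<delta> where \<delta>: "\<And>\<epsilon>. \<epsilon> > 0 \<Longrightarrow> \<delta> \<epsilon> > 0"
      "Limsup (at_right 0) (\<lambda>\<epsilon>. ereal (\<delta> \<epsilon> / \<epsilon>)) = \<infinity>"
      "\<And>\<epsilon> z. \<epsilon> > 0 \<Longrightarrow> z \<in> cball x (\<delta> \<epsilon>) \<Longrightarrow> f x + ereal (blinfun_apply xs (z - x)) \<le> f z + ereal \<epsilon>"
    using assms(1) unfolding core_subdifferential_def by blast
  have "\<exists>\<epsilon>. 0 < \<epsilon> \<and> \<epsilon> < e \<and> K < \<delta> \<epsilon> / \<epsilon>"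
  proof (rule ccontr)
    assume neg: "\<not> ?thesis"
    have "eventually (\<lambda>\<epsilon>. ereal (\<delta> \<epsilon> / \<epsilon>) \<le> ereal K) (at_right 0)"
      unfolding eventually_at_right_field using neg assms(3) by (intro exI[of _ e]) force
    then have "Limsup (at_right 0) (\<lambda>\<epsilon>. ereal (\<delta> \<epsilon> / \<epsilon>)) \<le> ereal K"
      by (rule Limsup_bounded)
    then show False using \<delta>(2) by simp
  qed
  then obtain \<epsilon> where e: "0 < \<epsilon>" "\<epsilon> < e" "K < \<delta> \<epsilon> / \<epsilon>" by blast
  show thesis
    by (rule that[of \<epsilon> "\<delta> \<epsilon>"]) (use e \<delta> in \<open>auto simp: field_simps\<close>)
qed

lemma closed_sublevel_add_continuous:
  fixes f :: "'a::metric_space \<Rightarrow> ereal" and h :: "'a \<Rightarrow> real"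
  assumes "closed S" and h: "continuous_on UNIV h"
    and lsc: "\<And>z d. z \<in> S \<Longrightarrow> d < f z \<Longrightarrow> eventually (\<lambda>u. d < f u) (nhds z)"
  shows "closed {z\<in>S. f z + ereal (h z) \<le> ereal c}"
  unfolding closed_sequential_limits
proof (intro allI impI, elim conjE)
  fix X l
  assume X: "\<forall>n. X n \<in> {z\<in>S. f z + ereal (h z) \<le> ereal c}" and lim: "X \<longlonglongrightarrow> l"
  have l: "l \<in> S"
    using X lim \<open>closed S\<close> unfolding closed_sequential_limits by blast
  have hl: "(\<lambda>n. c - h (X n)) \<longlonglongrightarrow> c - h l"
    by (intro tendsto_intros continuous_on_tendsto_compose[OF h lim]) auto
  have "f l \<le> ereal (c - h l)"
  proof (rule ccontr)
    assume "\<not> ?thesis"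
    then obtain d where d: "ereal (c - h l) < ereal d" "ereal d < f l"
      using ereal_dense2 by (metis not_le)
    have "eventually (\<lambda>n. ereal d < f (X n)) sequentially"
      using lsc[OF l d(2)] lim unfolding filterlim_def le_filter_def by (auto simp: eventually_filtermap)
    moreover have "eventually (\<lambda>n. c - h (X n) < d) sequentially"
      using d(1) by (intro order_tendstoD[OF hl]) simp
    ultimately have "eventually (\<lambda>n. False) sequentially"
    proof eventually_elim
      case (elim n)
      then have "f (X n) + ereal (h (X n)) \<le> ereal c" using X by blast
      then show False using elim by (cases "f (X n)") auto
    qed
    then show False by simp
  qed
  then show "l \<in> {z\<in>S. f z + ereal (h z) \<le> ereal c}"
    using l by (cases "f l") auto
qed

text \<open>
  The subgradients of \<open>t * norm (\<cdot> - y) - xs\<close> at \<open>y\<close> are the functionals at distance at most \<open>t\<close>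
  from \<open>- xs\<close>, so the Minkowski sum in the defining property becomes a norm estimate.
\<close>

lemma abstract_subdifferential_near:
  fixes f :: "'a::real_normed_vector \<Rightarrow> ereal"
  assumes D: "abstract_subdifferential D F" and f: "f \<in> F" "\<bar>f y\<bar> \<noteq> \<infinity>" "lsc_near f y"
    and t: "t \<ge> 0"
    and min: "local_minimum_point (\<lambda>u. f u + ereal (t * dist u y - blinfun_apply xs u)) y"
  obtains ys where "ys \<in> sw_Limsup f (D f) y" "dist ys xs \<le> t"
proof -
  define g where "g u = t * dist u y - blinfun_apply xs u" for u
  have conv: "convex_on UNIV g"
  proof (rule convex_onI)
    fix s :: real and u v :: 'a assume s: "0 < s" "s < 1"
    define w where "w = (1 - s) *\<^sub>R u + s *\<^sub>R v"
    have "dist y w \<le> (1 - s) * dist y u + s * dist y v"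
      unfolding w_def using s
      by (intro convex_onD[OF convex_on_dist[OF convex_UNIV, of y]]) auto
    then have "dist w y \<le> (1 - s) * dist u y + s * dist v y"
      by (metis dist_commute)
    then have "t * dist w y \<le> t * ((1 - s) * dist u y + s * dist v y)"
      using t by (rule mult_left_mono)
    moreover have "blinfun_apply xs w = (1 - s) * blinfun_apply xs u + s * blinfun_apply xs v"
      by (simp add: w_def blinfun.add_right blinfun.scaleR_right)
    ultimately have "g w \<le> (1 - s) * g u + s * g v"
      by (simp add: g_def algebra_simps)
    then show "g ((1 - s) *\<^sub>R u + s *\<^sub>R v) \<le> (1 - s) * g u + s * g v"
      by (simp only: w_def)
  qed simp
  have "continuous_on UNIV g"
    unfolding g_def by (intro continuous_intros)
  then have "0 \<in> sw_Limsup f (D f) y + fenchel_subdifferential g y"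
    using D[unfolded abstract_subdifferential_def, rule_format, OF f(1) conv _ f(2,3)]
      min[folded g_def] by blast
  then obtain a b where ab: "a \<in> sw_Limsup f (D f) y" "b \<in> fenchel_subdifferential g y" "0 = a + b"
    by (rule set_plus_elim)
  have ba: "b = - a" using ab(3) by (metis eq_neg_iff_add_eq_0 add.commute)
  have bound: "blinfun_apply (xs - a) v \<le> t * norm v" for v
  proof -
    have "g y + blinfun_apply b ((y + v) - y) \<le> g (y + v)"
      using ab(2) unfolding fenchel_subdifferential_def by blast
    then show ?thesis
      by (simp add: g_def ba blinfun.add_right blinfun.diff_left blinfun.minus_left dist_norm)
  qed
  have "norm (xs - a) \<le> t"
  proof (rule norm_blinfun_bound[OF t])
    show "norm (blinfun_apply (xs - a) v) \<le> t * norm v" for v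
      using bound[of v] bound[of "- v"] by (simp add: blinfun.minus_right abs_le_iff)
  qed
  then show thesis
    using ab(1) by (intro that[of a]) (auto simp: dist_norm norm_minus_commute)
qed

text \<open>
  Ekeland's principle is applied to the tilted function on a ball of radius \<open>\<rho> \<le> \<delta>\<^sub>\<epsilon>\<close>, allowing a
  displacement of at most \<open>\<rho> / 2\<close>: the point found is interior to the ball, hence a local minimizer,
  and the slope is \<open>2 \<epsilon> / \<rho>\<close>.
\<close>

lemma core_subdifferential_approx:
  fixes f :: "'a::banach \<Rightarrow> ereal"
  assumes D: "abstract_subdifferential D F" and f: "f \<in> F" "lsc_near f x"
    and core: "xs \<in> core_subdifferential f x" and \<eta>: "\<eta> > 0"
  obtains y ys where "ys \<in> sw_Limsup f (D f) y" "dist y x \<le> \<eta>" "dist ys xs \<le> \<eta>"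
    "\<bar>f y\<bar> \<noteq> \<infinity>" "\<bar>real_of_ereal (f y) - real_of_ereal (f x)\<bar> \<le> \<eta>"
proof -
  obtain c where c: "f x = ereal c"
    using core unfolding core_subdifferential_def by (cases "f x") auto
  obtain U where U: "open U" "x \<in> U"
    and lsc: "\<And>z d. z \<in> U \<Longrightarrow> d < f z \<Longrightarrow> eventually (\<lambda>u. d < f u) (nhds z)"
    using f(2) unfolding lsc_near_def by blast
  obtain r where r: "r > 0" "cball x r \<subseteq> U"
    using U by (meson open_contains_cball)
  define s where "s = min r (\<eta> / 2 / (1 + norm xs))"
  have n: "0 < 1 + norm xs" by (simp add: add_pos_nonneg)
  have s: "s > 0" "s \<le> r" using r \<eta> n by (auto simp: s_def)
  have s_bound: "(1 + norm xs) * s \<le> \<eta> / 2"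
  proof -
    have "(1 + norm xs) * s \<le> (1 + norm xs) * (\<eta> / 2 / (1 + norm xs))"
      using n by (intro mult_left_mono) (auto simp: s_def)
    also have "\<dots> = \<eta> / 2"
      using n nonzero_mult_div_cancel_left[of "1 + norm xs" "\<eta> / 2"]
      by (metis less_irrefl times_divide_eq_right)
    finally show ?thesis .
  qed
  \<comment> \<open>The choices of \<open>K\<close> and \<open>e\<close> make \<open>2 \<epsilon> / \<rho> \<le> \<eta>\<close> for both possible values of \<open>\<rho>\<close>; the second
    bound on \<open>\<epsilon>\<close> controls the values of \<open>f\<close>.\<close>
  have "2 / \<eta> > 0" "min (\<eta> * s / 2) (\<eta> / 2) > 0" using \<eta> s by auto
  from core_subdifferentialE[OF core this]
  obtain \<epsilon> \<delta> where \<epsilon>: "\<epsilon> > 0" "\<epsilon> < min (\<eta> * s / 2) (\<eta> / 2)" and \<delta>: "\<delta> > 0" "\<delta> > 2 / \<eta> * \<epsilon>"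
    and ineq: "\<And>z. z \<in> cball x \<delta> \<Longrightarrow> f x + ereal (blinfun_apply xs (z - x)) \<le> f z + ereal \<epsilon>"
    by metis
  define \<rho> where "\<rho> = min \<delta> s"
  have \<rho>: "\<rho> > 0" "\<rho> \<le> \<delta>" "\<rho> \<le> s" using \<delta> s by (auto simp: \<rho>_def)
  have slope: "\<epsilon> / (\<rho> / 2) \<le> \<eta>"
  proof -
    have "2 * \<epsilon> \<le> \<eta> * \<delta>" "2 * \<epsilon> \<le> \<eta> * s" using \<delta>(2) \<epsilon>(2) \<eta> by (auto simp: field_simps)
    then have "2 * \<epsilon> \<le> \<eta> * \<rho>" by (simp add: \<rho>_def min_def)
    then show ?thesis using \<rho>(1) by (simp add: field_simps)
  qed
  define S where "S = cball x \<rho>"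
  define h where "h z = - blinfun_apply xs (z - x)" for z
  have hx: "h x = 0" by (simp add: h_def)
  have below: "f x + ereal (h x) \<le> f z + ereal (h z) + ereal \<epsilon>" if "z \<in> S" for z
  proof -
    have "z \<in> cball x \<delta>" using that \<rho> by (simp add: S_def)
    from ineq[OF this] show ?thesis
      by (cases "f z") (auto simp: h_def c)
  qed
  have "continuous_on UNIV h"
    unfolding h_def by (intro continuous_intros)
  then have lev: "closed {z\<in>S. f z + ereal (h z) \<le> ereal d}" for d
    unfolding S_def
  proof (rule closed_sublevel_add_continuous[OF closed_cball])
    show "eventually (\<lambda>u. d < f u) (nhds z)" if "z \<in> cball x \<rho>" "d < f z" for z d
      using that r s \<rho> by (intro lsc) auto
  qed
  have S: "complete S" "x \<in> S" using \<rho> by (auto simp: S_def complete_eq_closed)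
  have fin: "\<bar>f x + ereal (h x)\<bar> \<noteq> \<infinity>" by (simp add: c)
  have "\<rho> / 2 > 0" using \<rho> by simp
  then obtain y where y: "y \<in> S" "dist y x \<le> \<rho> / 2" "f y + ereal (h y) \<le> f x + ereal (h x)"
    "\<And>z. z \<in> S \<Longrightarrow> f y + ereal (h y) \<le> f z + ereal (h z) + ereal (\<epsilon> / (\<rho> / 2) * dist z y)"
    by (rule Ekeland_ereal[where f = "\<lambda>z. f z + ereal (h z)", OF S \<epsilon>(1) _ fin below lev]) blast+
  obtain a where a: "f y = ereal a"
    using y(3) below[OF y(1)] c by (cases "f y") auto
  have "lsc_near f y"
    unfolding lsc_near_def using U(1) lsc y(1) r s \<rho> by (intro exI[of _ U]) (auto simp: S_def)
  moreover have "local_minimum_point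
      (\<lambda>u. f u + ereal (\<epsilon> / (\<rho> / 2) * dist u y - blinfun_apply xs u)) y"
    unfolding local_minimum_point_def
  proof (rule eventually_mono)
    show "eventually (\<lambda>u. u \<in> ball x \<rho>) (nhds y)"
      using y(2) \<rho>(1) by (intro eventually_nhds_in_open) (auto simp: dist_commute)
    fix u assume "u \<in> ball x \<rho>"
    then have "u \<in> S" by (simp add: S_def)
    from y(4)[OF this]
    show "f y + ereal (\<epsilon> / (\<rho> / 2) * dist y y - blinfun_apply xs y)
      \<le> f u + ereal (\<epsilon> / (\<rho> / 2) * dist u y - blinfun_apply xs u)"
      by (cases "f u") (auto simp: a h_def blinfun.diff_right)
  qed
  moreover have "\<epsilon> / (\<rho> / 2) \<ge> 0" using \<epsilon> \<rho> by simp
  ultimately obtain ys where ys: "ys \<in> sw_Limsup f (D f) y" "dist ys xs \<le> \<epsilon> / (\<rho> / 2)"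
    using abstract_subdifferential_near[OF D f(1), of y "\<epsilon> / (\<rho> / 2)" xs] a by auto
  have xs_s: "norm xs * s \<le> \<eta> / 2" "s \<le> \<eta> / 2"
    using s_bound s(1) by (auto simp: distrib_right intro: order_trans[rotated])
  have dist_s: "norm (y - x) \<le> s" using y(2) \<rho> by (simp add: dist_norm)
  have "\<bar>blinfun_apply xs (y - x)\<bar> \<le> norm xs * norm (y - x)"
    using norm_blinfun[of xs "y - x"] by simp
  also have "\<dots> \<le> norm xs * s"
    using dist_s by (intro mult_left_mono) auto
  finally have "\<bar>blinfun_apply xs (y - x)\<bar> \<le> \<eta> / 2" using xs_s by linarith
  moreover have "a \<le> c + blinfun_apply xs (y - x)" "c + blinfun_apply xs (y - x) \<le> a + \<epsilon>"
    using y(3) below[OF y(1)] by (auto simp: a c hx h_def)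
  ultimately have "\<bar>a - c\<bar> \<le> \<eta>" using \<epsilon> by auto
  then show thesis
    using ys slope dist_s xs_s \<eta> a c by (intro that[of ys y]) (auto simp: dist_norm)
qed

theorem theorem5:
  fixes F :: "('a::banach \<Rightarrow> ereal) set"
    and D :: "('a \<Rightarrow> ereal) \<Rightarrow> 'a \<Rightarrow> ('a \<Rightarrow>\<^sub>L real) set"
  assumes "F \<noteq> {}"
    and "abstract_subdifferential D F"
  shows "\<forall>x. \<forall>f\<in>F. lsc_near f x \<longrightarrow> core_subdifferential f x \<subseteq> sw_Limsup f (D f) x"
proof (intro allI ballI impI subsetI)
  fix x f xs
  assume f: "f \<in> F" "lsc_near f x" and core: "xs \<in> core_subdifferential f x"
  show "xs \<in> sw_Limsup f (D f) x"
  proof (rule sw_Limsup_norm_closed)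
    show "\<bar>f x\<bar> \<noteq> \<infinity>"
      using core by (simp add: core_subdifferential_def)
    show "\<exists>y ys. ys \<in> sw_Limsup f (D f) y \<and> dist y x \<le> \<eta> \<and> dist ys xs \<le> \<eta> \<and>
      \<bar>f y\<bar> \<noteq> \<infinity> \<and> \<bar>real_of_ereal (f y) - real_of_ereal (f x)\<bar> \<le> \<eta>" if "\<eta> > 0" for \<eta>
      using core_subdifferential_approx[OF assms(2) f core that] by metis
  qed
qed

end
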